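(* Let $r\ge 1$ be an integer, $\varepsilon\in(0,1)$, and let $Y_0\in\mathbb{R}^{n\times p}$ ($p\le n$) satisfy $\|Y_0^\top Y_0-I_p\|_{\mathrm F}\le\varepsilon$. Let $(Y_k)$ be the sequence generated from the initial point $Y_0$ by the order-$r$ Newton--Schulz iteration $$Y_{k+1}=Y_k\,q_r(Y_k^\top Y_k-I_p),\qquad q_r(S)=\sum_{j=0}^{r}(-1)^j\frac{(2j)!}{(j!)^2}\frac{S^j}{4^j}.$$ Then, for all $k\ge0$, $$\|Y_k^\top Y_k-I_p\|_{\mathrm F}\le\|Y_0^\top Y_0-I_p\|_{\mathrm F}^{(r+1)^k}\le\varepsilon^{(r+1)^k}.$$
   Context: $\|\cdot\|_{\mathrm F}$ is the Frobenius norm and $I_p$ the $p\times p$ identity matrix. The polynomial $q_r(S)$ is the degree-$r$ Taylor polynomial of $(I_p+S)^{-1/2}$ at $S=0$. *)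

theory Defs
  imports "HOL-Analysis.Analysis"
begin

text \<open>
  The overloaded \<open>*\<close> and \<open>^\<close> act entrywise on \<open>real ^ 'p ^ 'p\<close>, so powers with
  respect to the matrix product \<open>**\<close> are defined separately.
\<close>

primrec matrix_power :: "real ^ 'p ^ 'p \<Rightarrow> nat \<Rightarrow> real ^ 'p ^ 'p" where
  "matrix_power S 0 = mat 1"
| "matrix_power S (Suc j) = S ** matrix_power S j"

definition newton_schulz_poly :: "nat \<Rightarrow> real ^ 'p ^ 'p \<Rightarrow> real ^ 'p ^ 'p" where
  "newton_schulz_poly r S =
     (\<Sum>j=0..r. ((- 1) ^ j * (fact (2 * j) / (fact j)\<^sup>2) / 4 ^ j) *\<^sub>R matrix_power S j)"

definition newton_schulz_seq :: "nat \<Rightarrow> (nat \<Rightarrow> real ^ 'p ^ 'n) \<Rightarrow> bool" where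
  "newton_schulz_seq r Y \<longleftrightarrow>
     (\<forall>k. Y (Suc k) = Y k ** newton_schulz_poly r (transpose (Y k) ** Y k - mat 1))"

text \<open>The library norm on the nested vector type of matrices is the Frobenius norm.\<close>

lemma norm_matrix_eq_Frobenius:
  fixes A :: "real ^ 'p ^ 'n"
  shows "norm A = sqrt (\<Sum>i\<in>UNIV. \<Sum>j\<in>UNIV. (A $ i $ j)\<^sup>2)"
  by (simp add: norm_vec_def L2_set_def sum_nonneg)

end

theory Submission
  imports Defs "HOL-Computational_Algebra.Formal_Power_Series"
begin

text \<open>
  Put \<open>T = I - Y\<^sup>T Y\<close>, a symmetric matrix. Since \<open>q\<^sub>r\<close> is applied to \<open>- T\<close>, one step of the
  iteration replaces \<open>T\<close> by \<open>R(T)\<close>, where \<open>R(x) = 1 - (1 - x) Q(x)\<^sup>2\<close> and \<open>Q\<close> is the truncation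
  at degree \<open>r\<close> of \<open>(1 - x) powr (- 1/2) = (\<Sum>j. b\<^sub>j x\<^sup>j)\<close>; its coefficients \<open>b\<^sub>j\<close> are positive
  and decreasing.

  Three facts about the real polynomial \<open>R\<close> carry the proof. It vanishes to order \<open>r + 1\<close> at \<open>0\<close>,
  because \<open>Q\<^sup>2\<close> agrees with \<open>1/(1 - x)\<close> up to degree \<open>r\<close>. All its coefficients are
  nonnegative: above degree \<open>r\<close> they are successive differences of the coefficients of \<open>Q\<^sup>2\<close>, and
  these decrease because the \<open>b\<^sub>j\<close> do. Finally \<open>R(1) = 1\<close>, so the coefficients add up to \<open>1\<close>.
  Thus \<open>R(T)\<close> is a convex combination of powers \<open>T\<^sup>m\<close> with \<open>m \<ge> r + 1\<close>, and submultiplicativity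
  of the Frobenius norm gives \<open>\<parallel>R(T)\<parallel> \<le> \<parallel>T\<parallel> ^ (r + 1)\<close> as soon as \<open>\<parallel>T\<parallel> \<le> 1\<close>. The
  theorem follows by induction on \<open>k\<close>, since the bound keeps the norm below \<open>1\<close>.
\<close>

section \<open>Coefficients of the inverse square root\<close>

definition inv_sqrt_coeff :: "nat \<Rightarrow> real" where
  "inv_sqrt_coeff j = fact (2 * j) / (fact j)\<^sup>2 / 4 ^ j"

lemma inv_sqrt_coeff_pos: "inv_sqrt_coeff j > 0"
  by (simp add: inv_sqrt_coeff_def)

lemma inv_sqrt_coeff_Suc:
  "inv_sqrt_coeff (Suc j) = inv_sqrt_coeff j * ((2 * real j + 1) / (2 * real j + 2))"
proof -
  define c where "c = real j + 1"
  have "c \<noteq> 0"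
    by (simp add: c_def)
  have "(fact (2 * Suc j) :: real) = (2 * c) * ((2 * real j + 1) * fact (2 * j))"
    by (simp add: c_def algebra_simps)
  moreover have "(fact (Suc j) :: real) = c * fact j"
    by (simp add: c_def algebra_simps)
  moreover have "2 * real j + 2 = 2 * c"
    by (simp add: c_def)
  ultimately show ?thesis
    using \<open>c \<noteq> 0\<close> unfolding inv_sqrt_coeff_def
    by (simp only: power_Suc) (simp add: divide_simps power2_eq_square)
qed

lemma inv_sqrt_coeff_Suc_le: "inv_sqrt_coeff (Suc j) \<le> inv_sqrt_coeff j"
proof -
  have "inv_sqrt_coeff j * ((2 * real j + 1) / (2 * real j + 2)) \<le> inv_sqrt_coeff j * 1"
    using inv_sqrt_coeff_pos[of j] by (intro mult_left_mono) auto
  then show ?thesis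
    by (simp add: inv_sqrt_coeff_Suc)
qed

lemma inv_sqrt_coeff_eq_gbinomial: "inv_sqrt_coeff j = (- 1) ^ j * ((- 1 / 2) gchoose j)"
proof (induction j)
  case 0
  then show ?case by (simp add: inv_sqrt_coeff_def)
next
  case (Suc j)
  have "real (Suc j) * ((- 1 / 2 :: real) gchoose Suc j)
      = (- 1 / 2 - real j) * ((- 1 / 2) gchoose j)"
    using gbinomial_mult_1[of "- 1 / 2 :: real" j] by (simp add: algebra_simps)
  then have "((- 1 / 2 :: real) gchoose Suc j)
      = (- 1 / 2 - real j) * ((- 1 / 2) gchoose j) / real (Suc j)"
    by (simp add: field_simps)
  also have "\<dots> = - (((- 1 / 2) gchoose j) * ((2 * real j + 1) / (2 * real j + 2)))"
    by (simp add: field_simps)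
  finally show ?case
    using Suc by (simp add: inv_sqrt_coeff_Suc)
qed

text \<open>
  The square of the power series \<open>(1 - x) powr (- 1/2)\<close> is the geometric series; on coefficients
  this is Vandermonde's identity for the upper indices \<open>- 1/2\<close> and \<open>- 1/2\<close>.
\<close>

lemma inv_sqrt_coeff_convolution:
  "(\<Sum>i\<le>n. inv_sqrt_coeff i * inv_sqrt_coeff (n - i)) = 1"
proof -
  have "(\<Sum>i\<le>n. inv_sqrt_coeff i * inv_sqrt_coeff (n - i))
      = (\<Sum>i\<le>n. (- 1) ^ n * (((- 1 / 2) gchoose i) * ((- 1 / 2) gchoose (n - i))))"
    by (intro sum.cong refl)
      (auto simp: inv_sqrt_coeff_eq_gbinomial simp flip: power_add)
  also have "\<dots> = (- 1) ^ n * ((- 1 / 2 + - 1 / 2 :: real) gchoose n)"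
    unfolding gbinomial_Vandermonde[symmetric] by (simp add: sum_distrib_left atMost_atLeast0)
  also have "\<dots> = 1"
    using gbinomial_minus[of "1::real" n]
    by (simp add: binomial_gbinomial[symmetric] flip: power_add mult.assoc)
  finally show ?thesis .
qed

section \<open>The residual polynomial\<close>

definition inv_sqrt_poly :: "nat \<Rightarrow> real poly" where
  "inv_sqrt_poly r = (\<Sum>j\<le>r. monom (inv_sqrt_coeff j) j)"

lemma coeff_inv_sqrt_poly:
  "coeff (inv_sqrt_poly r) j = (if j \<le> r then inv_sqrt_coeff j else 0)"
  by (simp add: inv_sqrt_poly_def coeff_sum)

text \<open>
  For a scalar \<open>y\<close> and its successor \<open>z = y q\<^sub>r(y\<^sup>2 - 1)\<close>, this expresses the new error \<open>1 - z\<^sup>2\<close> as a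
  polynomial in the old error \<open>1 - y\<^sup>2\<close>.
\<close>

definition residual_poly :: "nat \<Rightarrow> real poly" where
  "residual_poly r = 1 - inv_sqrt_poly r * ([:1, - 1:] * inv_sqrt_poly r)"

text \<open>
  In the convolution for \<open>coeff (p * p) (Suc n)\<close> the summand \<open>coeff p 0 * coeff p (Suc n)\<close>
  vanishes; lowering the first index of every other summand by one can only increase it, and
  produces the convolution for \<open>n\<close>.
\<close>

lemma coeff_square_Suc_le:
  fixes p :: "real poly"
  assumes nonneg: "\<And>i. coeff p i \<ge> 0"
    and decreasing: "\<And>i. coeff p (Suc i) \<le> coeff p i"
    and "coeff p (Suc n) = 0"
  shows "coeff (p * p) (Suc n) \<le> coeff (p * p) n"
proof -
  have "coeff (p * p) (Suc n) = (\<Sum>i\<le>n. coeff p (Suc i) * coeff p (n - i))"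
    using assms(3) by (simp add: coeff_mult sum.atMost_Suc_shift del: sum.atMost_Suc)
  also have "\<dots> \<le> (\<Sum>i\<le>n. coeff p i * coeff p (n - i))"
    by (intro sum_mono mult_right_mono nonneg decreasing)
  finally show ?thesis
    by (simp add: coeff_mult)
qed

lemma coeff_inv_sqrt_poly_square:
  assumes "n \<le> r"
  shows "coeff (inv_sqrt_poly r * inv_sqrt_poly r) n = 1"
proof -
  have "coeff (inv_sqrt_poly r * inv_sqrt_poly r) n
      = (\<Sum>i\<le>n. inv_sqrt_coeff i * inv_sqrt_coeff (n - i))"
    unfolding coeff_mult using assms by (intro sum.cong) (auto simp: coeff_inv_sqrt_poly)
  then show ?thesis
    by (simp add: inv_sqrt_coeff_convolution)
qed

lemma residual_poly_eq:
  "residual_poly r = 1 - inv_sqrt_poly r * inv_sqrt_poly r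
     + pCons 0 (inv_sqrt_poly r * inv_sqrt_poly r)"
  by (simp add: residual_poly_def algebra_simps)

lemma coeff_residual_poly_Suc:
  "coeff (residual_poly r) (Suc n) = coeff (inv_sqrt_poly r * inv_sqrt_poly r) n
     - coeff (inv_sqrt_poly r * inv_sqrt_poly r) (Suc n)"
  by (simp add: residual_poly_eq)

lemma coeff_residual_poly_eq_0:
  assumes "n \<le> r"
  shows "coeff (residual_poly r) n = 0"
proof (cases n)
  case 0
  then show ?thesis
    using coeff_inv_sqrt_poly_square[of 0 r] by (simp add: residual_poly_eq)
next
  case (Suc m)
  then show ?thesis
    using assms by (simp add: coeff_residual_poly_Suc coeff_inv_sqrt_poly_square)
qed

lemma coeff_residual_poly_nonneg: "coeff (residual_poly r) n \<ge> 0"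
proof (cases "n \<le> r")
  case True
  then show ?thesis by (simp add: coeff_residual_poly_eq_0)
next
  case False
  then obtain m where m: "n = Suc m" "m \<ge> r"
    by (cases n) auto
  have "coeff (inv_sqrt_poly r * inv_sqrt_poly r) (Suc m)
      \<le> coeff (inv_sqrt_poly r * inv_sqrt_poly r) m"
    using m(2) inv_sqrt_coeff_pos inv_sqrt_coeff_Suc_le
    by (intro coeff_square_Suc_le) (auto simp: coeff_inv_sqrt_poly less_imp_le)
  then show ?thesis
    by (simp add: m coeff_residual_poly_Suc)
qed

lemma sum_coeff_residual_poly: "(\<Sum>m\<le>degree (residual_poly r). coeff (residual_poly r) m) = 1"
proof -
  have "poly (residual_poly r) 1 = 1"
    by (simp add: residual_poly_def)
  then show ?thesis
    by (simp add: poly_altdef)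
qed

section \<open>Submultiplicativity of the Frobenius norm\<close>

lemma norm_transpose:
  fixes A :: "real ^ 'm ^ 'n"
  shows "norm (transpose A) = norm A"
  unfolding norm_matrix_eq_Frobenius transpose_def by (simp, rule sum.swap)

lemma norm_power2_matrix:
  fixes A :: "real ^ 'm ^ 'n"
  shows "(norm A)\<^sup>2 = (\<Sum>i\<in>UNIV. (norm (A $ i))\<^sup>2)"
  by (simp add: norm_vec_def L2_set_def sum_nonneg)

text \<open>
  The entries of \<open>A ** B\<close> are inner products of rows of \<open>A\<close> with columns of \<open>B\<close>, so this is the
  Cauchy-Schwarz inequality summed over all entries.
\<close>

lemma norm_matrix_mult_le:
  fixes A :: "real ^ 'm ^ 'n" and B :: "real ^ 'k ^ 'm"
  shows "norm (A ** B) \<le> norm A * norm B"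
proof (rule power2_le_imp_le)
  have entry: "((A ** B) $ i $ j)\<^sup>2 \<le> (norm (A $ i))\<^sup>2 * (norm (transpose B $ j))\<^sup>2" for i j
  proof -
    have "(A ** B) $ i $ j = inner (A $ i) (transpose B $ j)"
      by (simp add: matrix_matrix_mult_def inner_vec_def transpose_def)
    then show ?thesis
      by (simp add: Cauchy_Schwarz_ineq power2_norm_eq_inner)
  qed
  have "(norm (A ** B))\<^sup>2 = (\<Sum>i\<in>UNIV. \<Sum>j\<in>UNIV. ((A ** B) $ i $ j)\<^sup>2)"
    by (simp add: norm_matrix_eq_Frobenius sum_nonneg)
  also have "\<dots> \<le> (\<Sum>i\<in>UNIV. \<Sum>j\<in>UNIV. (norm (A $ i))\<^sup>2 * (norm (transpose B $ j))\<^sup>2)"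
    by (intro sum_mono entry)
  also have "\<dots> = (norm A)\<^sup>2 * (norm (transpose B))\<^sup>2"
    by (simp add: norm_power2_matrix sum_product)
  finally show "(norm (A ** B))\<^sup>2 \<le> (norm A * norm B)\<^sup>2"
    by (simp add: norm_transpose power_mult_distrib)
qed simp

text \<open>
  The exponent \<open>0\<close> must be excluded: the Frobenius norm of the identity is the square root of the
  dimension, whereas \<open>norm T ^ 0 = 1\<close>.
\<close>

lemma norm_matrix_power_Suc_le:
  fixes T :: "real ^ 'p ^ 'p"
  shows "norm (matrix_power T (Suc n)) \<le> norm T ^ Suc n"
proof (induction n)
  case 0
  then show ?case by simp
next
  case (Suc n)
  have "norm (matrix_power T (Suc (Suc n))) \<le> norm T * norm (matrix_power T (Suc n))"
    using norm_matrix_mult_le[of T "matrix_power T (Suc n)"] by simp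
  also have "\<dots> \<le> norm T * norm T ^ Suc n"
    using Suc by (intro mult_left_mono) auto
  finally show ?case by simp
qed

section \<open>Real polynomials evaluated at a square matrix\<close>

lemma matrix_mult_scaleR:
  fixes A :: "real ^ 'm ^ 'n" and B :: "real ^ 'k ^ 'm"
  shows "(c *\<^sub>R A) ** B = c *\<^sub>R (A ** B)" and "A ** (c *\<^sub>R B) = c *\<^sub>R (A ** B)"
  by (simp_all add: matrix_matrix_mult_def vec_eq_iff sum_distrib_left mult_ac)

lemma matrix_mult_sum_right:
  fixes A :: "real ^ 'm ^ 'n" and B :: "'i \<Rightarrow> real ^ 'k ^ 'm"
  shows "A ** (\<Sum>i\<in>I. B i) = (\<Sum>i\<in>I. A ** B i)"
  by (induction I rule: infinite_finite_induct) (simp_all add: matrix_add_ldistrib)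

lemma matrix_mult_add_left:
  fixes A A' :: "real ^ 'm ^ 'n" and B :: "real ^ 'k ^ 'm"
  shows "(A + A') ** B = A ** B + A' ** B"
  by (simp add: matrix_matrix_mult_def vec_eq_iff sum.distrib algebra_simps)

definition matrix_poly :: "real poly \<Rightarrow> real ^ 'p ^ 'p \<Rightarrow> real ^ 'p ^ 'p" where
  "matrix_poly p T = (\<Sum>i\<le>degree p. coeff p i *\<^sub>R matrix_power T i)"

lemma matrix_poly_altdef:
  assumes "degree p \<le> n"
  shows "matrix_poly p T = (\<Sum>i\<le>n. coeff p i *\<^sub>R matrix_power T i)"
  unfolding matrix_poly_def
  using assms by (intro sum.mono_neutral_left) (auto simp: coeff_eq_0)

lemma matrix_poly_0 [simp]: "matrix_poly 0 T = 0"
  by (simp add: matrix_poly_def)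

lemma matrix_poly_pCons:
  "matrix_poly (pCons a p) T = a *\<^sub>R mat 1 + T ** matrix_poly p T"
proof -
  have "matrix_poly (pCons a p) T
      = (\<Sum>i\<le>Suc (degree p). coeff (pCons a p) i *\<^sub>R matrix_power T i)"
    by (rule matrix_poly_altdef) (rule degree_pCons_le)
  also have "\<dots> = a *\<^sub>R mat 1 + (\<Sum>i\<le>degree p. coeff p i *\<^sub>R (T ** matrix_power T i))"
    by (simp add: sum.atMost_Suc_shift del: sum.atMost_Suc)
  finally show ?thesis
    by (simp add: matrix_poly_def matrix_mult_sum_right matrix_mult_scaleR)
qed

lemma matrix_poly_1 [simp]: "matrix_poly 1 T = mat 1"
  by (simp add: one_pCons matrix_poly_pCons matrix_matrix_mult_def vec_eq_iff)

lemma matrix_poly_add: "matrix_poly (p + q) T = matrix_poly p T + matrix_poly q T"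
proof -
  define n where "n = max (degree p) (degree q)"
  have "degree (p + q) \<le> n"
    unfolding n_def by (rule degree_add_le_max)
  then show ?thesis
    by (simp add: matrix_poly_altdef[of _ n] n_def scaleR_add_left sum.distrib)
qed

lemma matrix_poly_smult: "matrix_poly (smult c p) T = c *\<^sub>R matrix_poly p T"
  by (simp add: matrix_poly_altdef[of _ "degree p"] scaleR_sum_right degree_smult_le)

lemma matrix_poly_diff: "matrix_poly (p - q) T = matrix_poly p T - matrix_poly q T"
  using matrix_poly_add[of p "- q" T] matrix_poly_smult[of "- 1" q T] by simp

lemma matrix_poly_mult: "matrix_poly (p * q) T = matrix_poly p T ** matrix_poly q T"
proof (induction p)
  case 0
  then show ?case by (simp add: matrix_matrix_mult_def vec_eq_iff)
next
  case (pCons a p)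
  have "matrix_poly (pCons a p * q) T
      = a *\<^sub>R matrix_poly q T + T ** (matrix_poly p T ** matrix_poly q T)"
    using pCons by (simp add: matrix_poly_add matrix_poly_smult matrix_poly_pCons)
  also have "\<dots> = matrix_poly (pCons a p) T ** matrix_poly q T"
    by (simp add: matrix_poly_pCons matrix_mult_add_left matrix_mult_scaleR matrix_mul_assoc)
  finally show ?case .
qed

lemma matrix_power_commute: "matrix_power T n ** T = T ** matrix_power T n"
  by (induction n) (simp_all flip: matrix_mul_assoc)

lemma transpose_matrix_poly:
  assumes "transpose T = T"
  shows "transpose (matrix_poly p T) = matrix_poly p T"
proof -
  have pow: "transpose (matrix_power T n) = matrix_power T n" for n
    by (induction n) (simp_all add: matrix_transpose_mul assms matrix_power_commute)
  have "linear (transpose :: real ^ 'a ^ 'a \<Rightarrow> _)"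
    by (rule linearI) (simp_all add: transpose_def vec_eq_iff)
  then show ?thesis
    by (simp add: matrix_poly_def linear_sum transpose_scalar pow)
qed

text \<open>
  Every power that occurs in \<open>matrix_poly p T\<close> has exponent at least \<open>d\<close>, hence norm at most
  \<open>norm T ^ d\<close>, and the coefficients weight these powers with total at most \<open>1\<close>. Nonnegativity is
  what lets the sum of the coefficients control the sum of their absolute values.
\<close>

lemma norm_matrix_poly_le_power:
  fixes T :: "real ^ 'p ^ 'p"
  assumes "norm T \<le> 1" and "d > 0"
    and vanish: "\<And>m. m < d \<Longrightarrow> coeff p m = 0"
    and nonneg: "\<And>m. coeff p m \<ge> 0"
    and total: "(\<Sum>m\<le>degree p. coeff p m) \<le> 1"
  shows "norm (matrix_poly p T) \<le> norm T ^ d"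
proof -
  have "norm (matrix_poly p T) \<le> (\<Sum>m\<le>degree p. norm (coeff p m *\<^sub>R matrix_power T m))"
    unfolding matrix_poly_def by (rule norm_sum)
  also have "\<dots> \<le> (\<Sum>m\<le>degree p. coeff p m * norm T ^ d)"
  proof (rule sum_mono)
    fix m
    show "norm (coeff p m *\<^sub>R matrix_power T m) \<le> coeff p m * norm T ^ d"
    proof (cases "m < d")
      case True
      then show ?thesis by (simp add: vanish)
    next
      case False
      then obtain n where n: "m = Suc n"
        using \<open>d > 0\<close> by (cases m) auto
      have "norm (matrix_power T m) \<le> norm T ^ m"
        unfolding n by (rule norm_matrix_power_Suc_le)
      also have "\<dots> \<le> norm T ^ d"
        using False assms(1) by (intro power_decreasing) auto
      finally show ?thesis
        using nonneg[of m] by (simp add: mult_left_mono)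
    qed
  qed
  also have "\<dots> = (\<Sum>m\<le>degree p. coeff p m) * norm T ^ d"
    by (simp add: sum_distrib_right)
  also have "\<dots> \<le> 1 * norm T ^ d"
    using total by (intro mult_right_mono) auto
  finally show ?thesis by simp
qed

section \<open>Convergence of the iteration\<close>

lemma matrix_power_uminus: "matrix_power (- T) n = (- 1) ^ n *\<^sub>R matrix_power T n"
proof (induction n)
  case 0
  then show ?case by simp
next
  case (Suc n)
  have "(- T) ** A = - (T ** A)" for A :: "real ^ 'a ^ 'a"
    by (simp add: matrix_matrix_mult_def vec_eq_iff sum_negf)
  then show ?case
    using Suc by (simp add: matrix_mult_scaleR)
qed

lemma newton_schulz_poly_uminus:
  "newton_schulz_poly r (- T) = matrix_poly (inv_sqrt_poly r) T"
proof -
  have "newton_schulz_poly r (- T) = (\<Sum>j\<le>r. inv_sqrt_coeff j *\<^sub>R matrix_power T j)"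
    unfolding newton_schulz_poly_def atMost_atLeast0
    by (intro sum.cong refl)
      (simp add: matrix_power_uminus inv_sqrt_coeff_def flip: power_add mult.assoc)
  also have "\<dots> = (\<Sum>j\<le>r. coeff (inv_sqrt_poly r) j *\<^sub>R matrix_power T j)"
    by (simp add: coeff_inv_sqrt_poly)
  also have "\<dots> = matrix_poly (inv_sqrt_poly r) T"
    by (rule matrix_poly_altdef[symmetric]) (auto intro: degree_le simp: coeff_inv_sqrt_poly)
  finally show ?thesis .
qed

text \<open>
  The scalar computation carries over because \<open>T\<close> is symmetric: then so is \<open>Q = q\<^sub>r(- T)\<close>, and
  \<open>(Y Q)\<^sup>T (Y Q) = Q (I - T) Q\<close> is a polynomial in \<open>T\<close> alone.
\<close>

lemma newton_schulz_step_residual: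
  fixes Y :: "real ^ 'p ^ 'n" and r :: nat
  defines "T \<equiv> mat 1 - transpose Y ** Y"
  defines "Z \<equiv> Y ** newton_schulz_poly r (transpose Y ** Y - mat 1)"
  shows "mat 1 - transpose Z ** Z = matrix_poly (residual_poly r) T"
proof -
  define Q where "Q = matrix_poly (inv_sqrt_poly r) T"
  have Z: "Z = Y ** Q"
    unfolding Z_def Q_def newton_schulz_poly_uminus[symmetric] by (simp add: T_def)
  have "transpose (A - B) = transpose A - transpose B" for A B :: "real ^ 'p ^ 'p"
    by (simp add: transpose_def vec_eq_iff)
  then have "transpose T = T"
    by (simp add: T_def matrix_transpose_mul)
  then have "transpose Q = Q"
    unfolding Q_def by (rule transpose_matrix_poly)
  then have "transpose Z ** Z = Q ** ((transpose Y ** Y) ** Q)"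
    by (simp add: Z matrix_transpose_mul matrix_mul_assoc)
  also have "transpose Y ** Y = matrix_poly [:1, - 1:] T"
    using matrix_mult_scaleR(2)[of T "- 1" "mat 1"] by (simp add: matrix_poly_pCons T_def)
  finally show ?thesis
    by (simp only: residual_poly_def Q_def matrix_poly_diff matrix_poly_mult matrix_poly_1)
qed

lemma newton_schulz_step_norm_le:
  fixes Y :: "real ^ 'p ^ 'n" and r :: nat
  defines "Z \<equiv> Y ** newton_schulz_poly r (transpose Y ** Y - mat 1)"
  assumes "norm (transpose Y ** Y - mat 1) \<le> 1"
  shows "norm (transpose Z ** Z - mat 1) \<le> norm (transpose Y ** Y - mat 1) ^ (r + 1)"
proof -
  define T where "T = mat 1 - transpose Y ** Y"
  have "norm (matrix_poly (residual_poly r) T) \<le> norm T ^ (r + 1)"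
  proof (rule norm_matrix_poly_le_power)
    show "norm T \<le> 1"
      using assms(2) by (simp add: T_def norm_minus_commute)
    show "(\<Sum>m\<le>degree (residual_poly r). coeff (residual_poly r) m) \<le> 1"
      by (simp add: sum_coeff_residual_poly)
  qed (simp_all add: coeff_residual_poly_eq_0 coeff_residual_poly_nonneg)
  then show ?thesis
    using newton_schulz_step_residual[of Y r]
    by (simp add: Z_def T_def norm_minus_commute)
qed

theorem proposition3p2:
  fixes r :: nat and \<epsilon> :: real and Y :: "nat \<Rightarrow> real ^ 'p ^ 'n"
  assumes "r \<ge> 1"
    and "0 < \<epsilon>" and "\<epsilon> < 1"
    and "CARD('p) \<le> CARD('n)"
    and "norm (transpose (Y 0) ** Y 0 - mat 1) \<le> \<epsilon>"
    and "newton_schulz_seq r Y"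
  shows "\<forall>k. norm (transpose (Y k) ** Y k - mat 1)
               \<le> norm (transpose (Y 0) ** Y 0 - mat 1) ^ ((r + 1) ^ k)
           \<and> norm (transpose (Y 0) ** Y 0 - mat 1) ^ ((r + 1) ^ k)
               \<le> \<epsilon> ^ ((r + 1) ^ k)"
proof (intro allI conjI)
  fix k
  define \<delta> where "\<delta> k = norm (transpose (Y k) ** Y k - mat 1)" for k
  have \<delta>0: "0 \<le> \<delta> 0" "\<delta> 0 \<le> \<epsilon>"
    using assms(5) by (simp_all add: \<delta>_def)
  have step: "\<delta> (Suc k) \<le> \<delta> k ^ (r + 1)" if "\<delta> k \<le> 1" for k
    using newton_schulz_step_norm_le[of "Y k" r] that assms(6)
    by (simp add: \<delta>_def newton_schulz_seq_def)
  have "\<delta> k \<le> \<delta> 0 ^ ((r + 1) ^ k)"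
  proof (induction k)
    case 0
    then show ?case by simp
  next
    case (Suc k)
    have "\<delta> 0 ^ ((r + 1) ^ k) \<le> 1"
      using \<delta>0 assms(3) by (intro power_le_one) auto
    then have "\<delta> (Suc k) \<le> \<delta> k ^ (r + 1)"
      using Suc by (intro step) simp
    also have "\<dots> \<le> (\<delta> 0 ^ ((r + 1) ^ k)) ^ (r + 1)"
      using Suc by (intro power_mono) (simp_all add: \<delta>_def)
    also have "\<dots> = \<delta> 0 ^ ((r + 1) ^ Suc k)"
      by (simp only: power_mult[symmetric] power_Suc2)
    finally show ?case .
  qed
  then show "norm (transpose (Y k) ** Y k - mat 1)
      \<le> norm (transpose (Y 0) ** Y 0 - mat 1) ^ ((r + 1) ^ k)"
    by (simp only: \<delta>_def)
  show "norm (transpose (Y 0) ** Y 0 - mat 1) ^ ((r + 1) ^ k) \<le> \<epsilon> ^ ((r + 1) ^ k)"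
    using assms(5) by (intro power_mono) simp_all
qed

end
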